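(* Let $k\ge 3$ be odd and let $G$ be an odd unicycle graph of girth $k$ whose unique cycle has vertices $u,u_1,\dots,u_{k-1}$ with $\deg u=4$ and $\deg u_i=2$ for $1\le i\le k-1$. Let $v_1$ and $w_1$ be the two neighbours of $u$ not on the cycle. If the Grover walk on $G$ is periodic, then either $\deg v_1=\deg w_1=1$ or $\deg v_1=\deg w_1=2$.
   Context: Graphs are simple, connected and finite. An odd unicycle graph is a non-bipartite graph with $|V|=|E|$, i.e. a connected graph with exactly one cycle, of odd length (its girth). For $G=(V,E)$, let $\mathcal{A}=\{(a,b),(b,a)\mid ab\in E\}$; for an arc $e=(a,b)$ write $o(e)=a$, $t(e)=b$, $\bar e=(b,a)$. The Grover walk has time evolution $U$ on $\mathbb{C}^{\mathcal{A}}$ with $U_{e,f}=2/\deg t(f)$ if $t(f)=o(e)$, $e\neq\bar f$; $U_{e,f}=2/\deg t(f)-1$ if $e=\bar f$; $0$ otherwise. The walk is periodic if $U^m=I$ for some positive integer $m$. *)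

theory Defs
  imports Main "HOL-Library.FuncSet" Complex_Main
begin

definition simple_graph :: "'a set \<Rightarrow> ('a \<Rightarrow> 'a \<Rightarrow> bool) \<Rightarrow> bool" where
  "simple_graph V E \<longleftrightarrow> finite V \<and> (\<forall>a b. E a b \<longrightarrow> a \<in> V \<and> b \<in> V)
     \<and> (\<forall>a b. E a b \<longrightarrow> E b a) \<and> (\<forall>a. \<not> E a a)"

definition graph_connected :: "'a set \<Rightarrow> ('a \<Rightarrow> 'a \<Rightarrow> bool) \<Rightarrow> bool" where
  "graph_connected V E \<longleftrightarrow> V \<noteq> {} \<and> (\<forall>x\<in>V. \<forall>y\<in>V. E\<^sup>*\<^sup>* x y)"

definition edges :: "('a \<Rightarrow> 'a \<Rightarrow> bool) \<Rightarrow> 'a set set" where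
  "edges E = {{a, b} | a b. E a b}"

definition bipartite :: "'a set \<Rightarrow> ('a \<Rightarrow> 'a \<Rightarrow> bool) \<Rightarrow> bool" where
  "bipartite V E \<longleftrightarrow> (\<exists>X. \<forall>a b. E a b \<longrightarrow> (a \<in> X \<longleftrightarrow> b \<notin> X))"

definition deg :: "('a \<Rightarrow> 'a \<Rightarrow> bool) \<Rightarrow> 'a \<Rightarrow> nat" where
  "deg E v = card {w. E v w}"

definition odd_unicycle :: "'a set \<Rightarrow> ('a \<Rightarrow> 'a \<Rightarrow> bool) \<Rightarrow> bool" where
  "odd_unicycle V E \<longleftrightarrow> simple_graph V E \<and> graph_connected V E
     \<and> \<not> bipartite V E \<and> card V = card (edges E)"

definition is_cycle :: "('a \<Rightarrow> 'a \<Rightarrow> bool) \<Rightarrow> nat \<Rightarrow> (nat \<Rightarrow> 'a) \<Rightarrow> bool" where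
  "is_cycle E n c \<longleftrightarrow> n \<ge> 3 \<and> inj_on c {0..<n} \<and> (\<forall>i<n. E (c i) (c ((i + 1) mod n)))"

definition girth :: "('a \<Rightarrow> 'a \<Rightarrow> bool) \<Rightarrow> nat" where
  "girth E = (LEAST n. \<exists>c. is_cycle E n c)"

definition arcs :: "('a \<Rightarrow> 'a \<Rightarrow> bool) \<Rightarrow> ('a \<times> 'a) set" where
  "arcs E = {(a, b). E a b}"

definition grover :: "('a \<Rightarrow> 'a \<Rightarrow> bool) \<Rightarrow> ('a \<times> 'a) \<Rightarrow> ('a \<times> 'a) \<Rightarrow> complex" where
  "grover E e f =
     (if snd f = fst e then
        (if e = (snd f, fst f) then 2 / of_nat (deg E (snd f)) - 1
         else 2 / of_nat (deg E (snd f)))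
      else 0)"

fun mat_pow :: "'b set \<Rightarrow> ('b \<Rightarrow> 'b \<Rightarrow> complex) \<Rightarrow> nat \<Rightarrow> 'b \<Rightarrow> 'b \<Rightarrow> complex" where
  "mat_pow A M 0 = (\<lambda>e f. if e = f then 1 else 0)"
| "mat_pow A M (Suc n) = (\<lambda>e f. \<Sum>g\<in>A. M e g * mat_pow A M n g f)"

definition grover_periodic :: "('a \<Rightarrow> 'a \<Rightarrow> bool) \<Rightarrow> bool" where
  "grover_periodic E \<longleftrightarrow> (\<exists>m>0. \<forall>e\<in>arcs E. \<forall>f\<in>arcs E.
       mat_pow (arcs E) (grover E) m e f = (if e = f then 1 else 0))"

end

(*
Write k = 2l + 1 and let f be the sum of the two arcs m, m' of the cycle edge opposite to u. By the
reflection symmetry of the cycle, U^n f takes a common value a_n on m and m'. Deleting the edge m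
leaves a tree, whose 2-colouring gives a diagonal sign matrix s with s U s = -U except on m and m';
hence the generating function A(w) of (a_n) satisfies A(w) + A(-w) = 2 A(w) A(-w). If the walk is
periodic, the rational sequence (a_n) has a common denominator, and a Gauss lemma argument on this
identity shows that every a_n is an integer. Following the wave once around the cycle and one step
into the tree gives a_(k+2) = 1/deg v1 + 1/deg w1 - 1.
*)
theory Submission
  imports Defs "HOL-Computational_Algebra.Primes"
begin

section \<open>Integrality of rational sequences\<close>

text \<open>Gauss's lemma for A(w) A(-w), where A generates \<open>a\<close>. Let N be the least
  common denominator and F = N a. If a prime p divided N, some F_i would not be divisible by p,
  since otherwise N/p would do. For the first such i, the coefficient of F(w) F(-w) at 2i is F_i^2
  up to sign modulo p, yet it equals N F_(2i), a multiple of p.\<close>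

lemma twisted_convolution_integral:
  fixes a :: "nat \<Rightarrow> 'a::field_char_0"
  assumes "M > 0" and int: "\<And>n. of_nat M * a n \<in> \<int>"
    and conv: "\<And>n. even n \<Longrightarrow> (\<Sum>j\<le>n. (-1) ^ j * a j * a (n - j)) = a n"
  shows "a n \<in> \<int>"
proof -
  define P where "P N \<longleftrightarrow> N > 0 \<and> (\<forall>n. of_nat N * a n \<in> \<int>)" for N
  define N where "N = (LEAST N. P N)"
  have "P M" using assms by (simp add: P_def)
  then have PN: "P N" unfolding N_def by (rule LeastI)
  then have "\<forall>n. \<exists>z. of_nat N * a n = of_int z" unfolding P_def by (metis Ints_cases)
  then obtain F where F: "\<And>n. of_nat N * a n = of_int (F n)" by metis
  have "N = 1"
  proof (rule ccontr)
    assume "N \<noteq> 1"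
    then obtain p where p: "prime p" "p dvd N" using prime_factor_nat by blast
    then obtain N' where N': "N = p * N'" by blast
    have "N' > 0" "N' < N" using PN N' prime_gt_1_nat[OF p(1)] by (auto simp: P_def)
    then have "\<not> P N'" unfolding N_def using not_less_Least by blast
    have "\<exists>i. \<not> int p dvd F i"
    proof (rule ccontr)
      assume "\<nexists>i. \<not> int p dvd F i"
      then have "\<forall>i. \<exists>z. F i = int p * z" by (auto simp: dvd_def)
      then obtain z where z: "\<And>i. F i = int p * z i" by metis
      have "of_nat N' * a i = of_int (z i)" for i
      proof -
        have "of_nat p * (of_nat N' * a i) = of_nat p * (of_int (z i) :: 'a)"
          using F[of i] by (simp add: N' z mult.assoc)
        then show ?thesis using p(1) by (auto simp: prime_gt_0_nat)
      qed
      then have "P N'" using \<open>N' > 0\<close> by (simp add: P_def)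
      then show False using \<open>\<not> P N'\<close> by blast
    qed
    then obtain i where i: "\<not> int p dvd F i" "\<And>j. j < i \<Longrightarrow> int p dvd F j"
      using exists_least_iff[of "\<lambda>i. \<not> int p dvd F i"] by blast
    have "(of_int (\<Sum>j\<le>2*i. (-1) ^ j * F j * F (2 * i - j)) :: 'a)
        = (\<Sum>j\<le>2*i. (-1) ^ j * (of_nat N * a j) * (of_nat N * a (2 * i - j)))"
      by (simp add: F)
    also have "\<dots> = of_nat N * of_nat N * (\<Sum>j\<le>2*i. (-1) ^ j * a j * a (2 * i - j))"
      by (simp add: sum_distrib_left mult_ac)
    also have "\<dots> = of_int (int N * F (2 * i))"
      using conv[of "2 * i"] by (simp add: F[symmetric])
    finally have eq: "(\<Sum>j\<le>2*i. (-1) ^ j * F j * F (2 * i - j)) = int N * F (2 * i)"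
      by (simp only: of_int_eq_iff)
    have "(\<Sum>j\<le>2*i. (-1) ^ j * F j * F (2 * i - j))
        = (-1) ^ i * F i * F i + (\<Sum>j\<in>{..2*i} - {i}. (-1) ^ j * F j * F (2 * i - j))"
      by (subst sum.remove[of _ i]) auto
    moreover have "int p dvd (\<Sum>j\<in>{..2*i} - {i}. (-1) ^ j * F j * F (2 * i - j))"
    proof (rule dvd_sum)
      fix j assume "j \<in> {..2*i} - {i}"
      then have "j < i \<or> 2 * i - j < i" by auto
      then show "int p dvd (-1) ^ j * F j * F (2 * i - j)"
        using i(2) by (auto intro: dvd_mult dvd_mult2)
    qed
    moreover have "int p dvd int N * F (2 * i)" using p(2) by (simp add: dvd_mult2)
    ultimately have "int p dvd (-1) ^ i * F i * F i"
      unfolding eq by (simp only: dvd_add_left_iff)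
    then have "int p dvd F i * F i"
      by (cases "even i") simp_all
    then show False using i(1) p(1) by (simp add: prime_dvd_mult_iff)
  qed
  then show ?thesis using F[of n] by simp
qed

lemma common_denominator:
  fixes a :: "nat \<Rightarrow> 'a::field_char_0"
  assumes "\<And>n. a n \<in> \<rat>"
  shows "\<exists>M>0. \<forall>i<n. of_nat M * a i \<in> \<int>"
proof (induction n)
  case 0
  then show ?case by auto
next
  case (Suc n)
  then obtain M where M: "M > 0" "\<forall>i<n. of_nat M * a i \<in> \<int>" by blast
  obtain p q where q: "q > 0" "a n = of_int p / of_int q"
    using assms[of n] by (metis Rats_cases')
  have q': "of_nat (nat q) = (of_int q :: 'a)" using q(1) by (simp add: of_nat_nat)
  have "of_nat (M * nat q) * a i \<in> \<int>" if "i < Suc n" for i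
  proof (cases "i = n")
    case True
    have "of_nat (M * nat q) * a n = (of_nat M * of_int p :: 'a)"
      using q by (simp add: q')
    then show ?thesis using True by (simp only: Ints_of_int Ints_mult Ints_of_nat)
  next
    case False
    then have "of_nat M * a i \<in> \<int>" using M that by simp
    then have "(of_nat M * a i) * of_int q \<in> \<int>" by simp
    then show ?thesis by (simp add: q' mult_ac)
  qed
  moreover have "M * nat q > 0" using M q by simp
  ultimately show ?case by blast
qed

text \<open>All values already occur below index \<open>m\<close>, so clearing finitely many
  denominators is enough.\<close>

lemma periodic_common_denominator:
  fixes a :: "nat \<Rightarrow> 'a::field_char_0"
  assumes "\<And>n. a n \<in> \<rat>" and "m > 0" and "\<And>n. a (n + m) = a n"
  shows "\<exists>M>0. \<forall>n. of_nat M * a n \<in> \<int>"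
proof -
  obtain M where M: "M > 0" "\<forall>i<m. of_nat M * a i \<in> \<int>"
    using common_denominator[of a m] assms(1) by blast
  have "a (i + q * m) = a i" for i q
  proof (induction q)
    case (Suc q)
    have "i + Suc q * m = (i + q * m) + m" by simp
    then show ?case using assms(3)[of "i + q * m"] Suc by (simp only:)
  qed simp
  then have "a n = a (n mod m)" for n
    by (metis mod_div_mult_eq)
  then show ?thesis using M assms(2) by (metis mod_less_divisor)
qed

section \<open>Orbit of a vector under a matrix\<close>

text \<open>This is M^n f, built by applying M to a vector, so that one step of the walk can be read
  off locally; \<open>mat_pow\<close> enters only to express periodicity.\<close>

fun evolve :: "'b set \<Rightarrow> ('b \<Rightarrow> 'b \<Rightarrow> complex) \<Rightarrow> ('b \<Rightarrow> complex) \<Rightarrow> nat \<Rightarrow> 'b \<Rightarrow> complex" where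
  "evolve A M f 0 = f"
| "evolve A M f (Suc n) = (\<lambda>e. \<Sum>g\<in>A. M e g * evolve A M f n g)"

lemma evolve_eq_mat_pow:
  assumes "finite A" "e \<in> A"
  shows "evolve A M f n e = (\<Sum>g\<in>A. mat_pow A M n e g * f g)"
  using assms(2)
proof (induction n arbitrary: e)
  case 0
  then show ?case using assms(1) by (simp add: if_distrib[of "\<lambda>x. x * _"] cong: if_cong)
next
  case (Suc n)
  have "evolve A M f (Suc n) e = (\<Sum>h\<in>A. \<Sum>g\<in>A. M e h * mat_pow A M n h g * f g)"
    using Suc.IH by (simp add: sum_distrib_left mult.assoc)
  also have "\<dots> = (\<Sum>g\<in>A. \<Sum>h\<in>A. M e h * mat_pow A M n h g * f g)"
    by (rule sum.swap)
  finally show ?case by (simp add: sum_distrib_right)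
qed

lemma evolve_periodic:
  assumes "finite A" and "\<forall>e\<in>A. \<forall>g\<in>A. mat_pow A M m e g = (if e = g then 1 else 0)" and "e \<in> A"
  shows "evolve A M f (n + m) e = evolve A M f n e"
  using assms(3)
proof (induction n arbitrary: e)
  case 0
  then show ?case using assms(1,2)
    by (simp add: evolve_eq_mat_pow if_distrib[of "\<lambda>x. x * _"] cong: if_cong)
next
  case (Suc n)
  then show ?case by simp
qed

lemma Rats_sum:
  fixes f :: "'b \<Rightarrow> 'a::field_char_0"
  assumes "\<And>x. x \<in> A \<Longrightarrow> f x \<in> \<rat>"
  shows "sum f A \<in> \<rat>"
  using assms
proof (induction A rule: infinite_finite_induct)
  case (insert x F)
  then have "f x \<in> \<rat>" "sum f F \<in> \<rat>" by blast+
  then show ?case using insert.hyps by simp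
qed simp_all

lemma evolve_Rats:
  assumes "\<And>e g. M e g \<in> \<rat>" "\<And>e. f e \<in> \<rat>"
  shows "evolve A M f n e \<in> \<rat>"
proof (induction n arbitrary: e)
  case (Suc n)
  show ?case unfolding evolve.simps by (intro Rats_sum Rats_mult assms(1) Suc)
qed (use assms(2) in simp)

text \<open>Serves to follow two unit pulses through the graph, one matrix column per pulse.\<close>

lemma evolve_Suc_two_points:
  assumes "finite A" "g \<in> A" "h \<in> A"
    and "\<And>e. e \<in> A \<Longrightarrow> evolve A M f n e = of_bool (e = g) + of_bool (e = h)"
  shows "evolve A M f (Suc n) e = M e g + M e h"
proof -
  have "evolve A M f (Suc n) e = (\<Sum>x\<in>A. M e x * of_bool (x = g)) + (\<Sum>x\<in>A. M e x * of_bool (x = h))"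
    using assms(4) by (simp add: distrib_left sum.distrib)
  moreover have "(\<Sum>x\<in>A. M e x * of_bool (x = y)) = M e y" if "y \<in> A" for y
    using assms(1) that by (simp add: of_bool_def if_distrib[of "\<lambda>x. _ * x"] cong: if_cong)
  ultimately show ?thesis using assms(2,3) by simp
qed

text \<open>Read \<open>s\<close> and \<open>f\<close> also as diagonal matrices S and P. Then S M =
  M (2P - S) and P M^n f = a_n f give the recursion S M^(n+1) f = 2 a_n M f - M (S M^n f), which
  starts at S f = f; the formula unrolls it.\<close>

lemma evolve_sign_twist:
  assumes sign: "\<And>e g. e \<in> A \<Longrightarrow> g \<in> A \<Longrightarrow> s e * M e g = M e g * (2 * f g - s g)"
    and coef: "\<And>n g. g \<in> A \<Longrightarrow> f g * evolve A M f n g = a n * f g"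
    and "\<And>e. e \<in> A \<Longrightarrow> s e * f e = f e" and "e \<in> A"
  shows "s e * evolve A M f n e
    = (-1) ^ n * evolve A M f n e + 2 * (\<Sum>j<n. (-1) ^ (n - 1 - j) * a j * evolve A M f (n - j) e)"
  using assms(4)
proof (induction n arbitrary: e)
  case 0
  then show ?case using assms(3) by simp
next
  case (Suc n)
  let ?p = "evolve A M f"
  have "s e * ?p (Suc n) e = (\<Sum>g\<in>A. (s e * M e g) * ?p n g)"
    by (simp add: sum_distrib_left mult.assoc)
  also have "\<dots> = (\<Sum>g\<in>A. M e g * (2 * (f g * ?p n g)) - M e g * (s g * ?p n g))"
    by (rule sum.cong) (use Suc.prems in \<open>auto simp: sign algebra_simps simp del: evolve.simps\<close>)
  also have "\<dots> = (\<Sum>g\<in>A. 2 * a n * (M e g * f g) - (-1) ^ n * (M e g * ?p n g)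
      - 2 * (\<Sum>j<n. (-1) ^ (n - 1 - j) * a j * (M e g * ?p (n - j) g)))"
    by (rule sum.cong) (use Suc.IH coef in \<open>auto simp: algebra_simps sum_distrib_left\<close>)
  also have "\<dots> = 2 * a n * ?p 1 e - (-1) ^ n * ?p (Suc n) e
      - 2 * (\<Sum>g\<in>A. \<Sum>j<n. (-1) ^ (n - 1 - j) * a j * (M e g * ?p (n - j) g))"
    by (simp add: sum_subtractf sum_distrib_left)
  also have "(\<Sum>g\<in>A. \<Sum>j<n. (-1) ^ (n - 1 - j) * a j * (M e g * ?p (n - j) g))
      = (\<Sum>j<n. (-1) ^ (n - 1 - j) * a j * ?p (Suc (n - j)) e)"
    by (subst sum.swap) (simp add: sum_distrib_left)
  \<comment> \<open>Raising the exponent from n - 1 - j to n - j flips the sign, as needed for the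
    sum at \<open>Suc n\<close>; the separate term 2 a_n M f becomes its summand j = n.\<close>
  also have "\<dots> = - (\<Sum>j<n. (-1) ^ (n - j) * a j * ?p (Suc n - j) e)"
  proof -
    have "(-1) ^ (n - 1 - j) * a j * ?p (Suc (n - j)) e
        = - ((-1) ^ (n - j) * a j * ?p (Suc n - j) e)" if "j < n" for j
    proof -
      define i where "i = n - 1 - j"
      have "n - j = Suc i" "Suc n - j = Suc (Suc i)" using that by (simp_all add: i_def)
      then show ?thesis unfolding i_def[symmetric] by (simp only: power_Suc) simp
    qed
    then show ?thesis by (simp add: sum_negf[symmetric])
  qed
  finally show ?case by (simp add: algebra_simps)
qed

text \<open>Evaluate the twist formula at an \<open>e\<close> with s e = f e = 1, where M^j f has
  value a_j. For even n the terms a_n cancel, so the sum over j < n vanishes, and the term j = n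
  contributes a_n a_0 = a_n.\<close>

lemma evolve_return_convolution:
  assumes "\<And>e g. e \<in> A \<Longrightarrow> g \<in> A \<Longrightarrow> s e * M e g = M e g * (2 * f g - s g)"
    and coef: "\<And>n g. g \<in> A \<Longrightarrow> f g * evolve A M f n g = a n * f g"
    and sf: "\<And>e. e \<in> A \<Longrightarrow> s e * f e = f e" and e: "e \<in> A" "f e = 1" and "even n"
  shows "(\<Sum>j\<le>n. (-1) ^ j * a j * a (n - j)) = a n"
proof -
  have s: "s e = 1" using sf e by fastforce
  have p: "evolve A M f j e = a j" for j using coef[of e j] e by simp
  have a0: "a 0 = 1" using p[of 0] e by simp
  have eq: "a n = a n + 2 * (\<Sum>j<n. (-1) ^ (n - 1 - j) * a j * a (n - j))"
    using evolve_sign_twist[OF assms(1) coef sf e(1), of n] \<open>even n\<close> by (simp add: s p)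
  have "(-1) ^ (n - 1 - j) * a j * a (n - j) = - ((-1) ^ j * a j * a (n - j))" if "j < n" for j
  proof -
    have "even (n - 1 - j) \<longleftrightarrow> odd j" using that \<open>even n\<close> by presburger
    then show ?thesis by (cases "even j") auto
  qed
  then have "(\<Sum>j<n. (-1) ^ (n - 1 - j) * a j * a (n - j)) = - (\<Sum>j<n. (-1) ^ j * a j * a (n - j))"
    by (simp add: sum_negf[symmetric])
  then have "(\<Sum>j<n. (-1) ^ j * a j * a (n - j)) = 0" using eq by simp
  then show ?thesis using \<open>even n\<close> by (simp add: lessThan_Suc_atMost[symmetric] a0)
qed

section \<open>Two-colouring after deletion of a cycle edge\<close>

text \<open>Each vertex other than a root \<open>r\<close> chooses a neighbour one step closer to
  \<open>r\<close>. These |V| - 1 parent edges are distinct, hence they are all the edges, and the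
  parity of the distance to \<open>r\<close> is a 2-colouring.\<close>

lemma tree_bipartite:
  assumes simple: "simple_graph V E" and conn: "graph_connected V E"
    and card: "card V = Suc (card (edges E))"
  shows "bipartite V E"
proof -
  obtain r where r: "r \<in> V" using conn by (auto simp: graph_connected_def)
  define d where "d x = (LEAST n. (E ^^ n) r x)" for x
  have dE: "(E ^^ d x) r x" if "x \<in> V" for x
  proof -
    have "E\<^sup>*\<^sup>* r x" using conn r that by (auto simp: graph_connected_def)
    then obtain n where "(E ^^ n) r x" by (auto simp: rtranclp_is_Sup_relpowp)
    then show ?thesis unfolding d_def by (rule LeastI)
  qed
  have "\<exists>y. E y x \<and> d x = Suc (d y)" if x: "x \<in> V - {r}" for x
  proof -
    have "d x \<noteq> 0" using dE[of x] x by (metis DiffD1 DiffD2 relpowp_0_E singletonI)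
    then obtain n where n: "d x = Suc n" by (metis not0_implies_Suc)
    then obtain y where y: "(E ^^ n) r y" "E y x" using dE[of x] x by auto
    have "d y \<le> n" unfolding d_def using y(1) by (rule Least_le)
    moreover have "y \<in> V" using y(2) simple by (auto simp: simple_graph_def)
    then have "(E ^^ Suc (d y)) r x" using dE y(2) by auto
    then have "d x \<le> Suc (d y)" unfolding d_def[of x] by (rule Least_le)
    ultimately show ?thesis using n y by auto
  qed
  then obtain p where p: "\<And>x. x \<in> V - {r} \<Longrightarrow> E (p x) x \<and> d x = Suc (d (p x))" by metis
  have finV: "finite V" using simple by (simp add: simple_graph_def)
  have "edges E \<subseteq> Pow V" using simple by (auto simp: edges_def simple_graph_def)
  then have fin: "finite (edges E)" using finV by (simp add: finite_subset)
  \<comment> \<open>If two vertices shared a parent edge, each would be the parent of the other,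
    contradicting the distances.\<close>
  have "inj_on (\<lambda>x. {p x, x}) (V - {r})"
  proof (rule inj_onI)
    fix x y assume "x \<in> V - {r}" "y \<in> V - {r}" "{p x, x} = {p y, y}"
    then show "x = y" using p[of x] p[of y] by (auto simp: doubleton_eq_iff)
  qed
  then have "card ((\<lambda>x. {p x, x}) ` (V - {r})) = card (edges E)"
    using card r finV by (simp add: card_image)
  moreover have "(\<lambda>x. {p x, x}) ` (V - {r}) \<subseteq> edges E" using p by (auto simp: edges_def)
  ultimately have img: "(\<lambda>x. {p x, x}) ` (V - {r}) = edges E"
    using fin by (simp add: card_subset_eq)
  have "even (d a) \<longleftrightarrow> odd (d b)" if "E a b" for a b
  proof -
    have "{a, b} \<in> edges E" using that by (auto simp: edges_def)
    then obtain x where "x \<in> V - {r}" "{a, b} = {p x, x}" using img by (metis (no_types, lifting) imageE)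
    then show ?thesis using p[of x] by (auto simp: doubleton_eq_iff)
  qed
  then show ?thesis unfolding bipartite_def by (intro exI[of _ "{x. even (d x)}"]) auto
qed

text \<open>The path shows that deleting the edge pq keeps the graph connected, so a tree remains,
  with a 2-colouring. Its colours agree at p and q, as otherwise the whole graph would be bipartite.
  Signs normalised to 1 there cancel along tree edges and add up to 2 along pq.\<close>

lemma odd_unicycle_signing:
  assumes uni: "odd_unicycle V E" and pq: "E p q"
    and path: "(\<lambda>x y. E x y \<and> {x, y} \<noteq> {p, q})\<^sup>*\<^sup>* p q"
  obtains s :: "'a \<Rightarrow> complex" where "s p = 1" "s q = 1"
    and "\<And>x y. E x y \<Longrightarrow> s x + s y = 2 * of_bool ({x, y} = {p, q})"
proof -
  define E' where "E' x y \<longleftrightarrow> E x y \<and> {x, y} \<noteq> {p, q}" for x y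
  have simple: "simple_graph V E" and conn: "graph_connected V E"
    and nbip: "\<not> bipartite V E" and card: "card V = card (edges E)"
    using uni by (auto simp: odd_unicycle_def)
  have sym: "E y x" if "E x y" for x y using simple that by (auto simp: simple_graph_def)
  have simple': "simple_graph V E'"
    using simple unfolding simple_graph_def E'_def by (auto simp: insert_commute)
  have path': "E'\<^sup>*\<^sup>* p q" using path by (simp add: E'_def[abs_def])
  have "symp E'" using sym by (auto simp: symp_def E'_def insert_commute)
  then have "symp (E'\<^sup>*\<^sup>*)" by (rule symp_rtranclp)
  then have "E'\<^sup>*\<^sup>* q p" using path' by (rule sympD)
  then have edge: "E'\<^sup>*\<^sup>* x y" if "E x y" for x y
    using that path' by (cases "{x, y} = {p, q}") (auto simp: E'_def doubleton_eq_iff)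
  have "E'\<^sup>*\<^sup>* x y" if "E\<^sup>*\<^sup>* x y" for x y
    using that by (induction rule: rtranclp_induct) (auto intro: rtranclp_trans edge)
  then have conn': "graph_connected V E'" using conn by (auto simp: graph_connected_def)
  have "edges E \<subseteq> Pow V" using simple by (auto simp: edges_def simple_graph_def)
  then have fin: "finite (edges E)" using simple by (auto simp: simple_graph_def intro: finite_subset)
  have "edges E' = edges E - {{p, q}}" by (auto simp: edges_def E'_def)
  moreover have mem: "{p, q} \<in> edges E" using pq by (auto simp: edges_def)
  ultimately have "card V = Suc (card (edges E'))"
    using card card_Suc_Diff1[OF fin mem] by simp
  then have "bipartite V E'" using tree_bipartite simple' conn' by blast
  then obtain X where X: "\<And>a b. E' a b \<Longrightarrow> a \<in> X \<longleftrightarrow> b \<notin> X" by (auto simp: bipartite_def)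
  have same: "p \<in> X \<longleftrightarrow> q \<in> X"
  proof (rule ccontr)
    assume "(p \<in> X) \<noteq> (q \<in> X)"
    then have "a \<in> X \<longleftrightarrow> b \<notin> X" if "E a b" for a b
      using X[of a b] that by (auto simp: E'_def doubleton_eq_iff)
    then have "bipartite V E" unfolding bipartite_def by blast
    then show False using nbip by contradiction
  qed
  define s :: "'a \<Rightarrow> complex" where "s x = (if x \<in> X \<longleftrightarrow> p \<in> X then 1 else -1)" for x
  have "s x + s y = 2 * of_bool ({x, y} = {p, q})" if "E x y" for x y
  proof (cases "{x, y} = {p, q}")
    case True
    then show ?thesis using same by (auto simp: s_def doubleton_eq_iff)
  next
    case False
    then show ?thesis using X[of x y] that by (auto simp: s_def E'_def)
  qed
  then show thesis using that[of s] same by (simp add: s_def)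
qed

section \<open>Local rules of the Grover walk\<close>

lemma finite_arcs:
  assumes "simple_graph V E"
  shows "finite (arcs E)"
proof (rule finite_subset)
  show "arcs E \<subseteq> V \<times> V" using assms by (auto simp: arcs_def simple_graph_def)
qed (use assms in \<open>simp add: simple_graph_def\<close>)

text \<open>Only arcs ending at x feed (x, y), all with weight 2/deg x; the extra -1 affects just
  the reversed arc (y, x).\<close>

lemma evolve_grover_Suc:
  assumes simple: "simple_graph V E" and "E x y"
  shows "evolve (arcs E) (grover E) f (Suc n) (x, y)
    = 2 / of_nat (deg E x) * (\<Sum>z | E x z. evolve (arcs E) (grover E) f n (z, x))
      - evolve (arcs E) (grover E) f n (y, x)"
proof -
  let ?p = "evolve (arcs E) (grover E) f n"
  have sym: "E a b \<longleftrightarrow> E b a" for a b using simple by (auto simp: simple_graph_def)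
  have finN: "finite {z. E x z}"
    using simple by (auto simp: simple_graph_def intro!: finite_subset[of "{z. E x z}" V])
  have "evolve (arcs E) (grover E) f (Suc n) (x, y) = (\<Sum>g\<in>(\<lambda>z. (z, x)) ` {z. E x z}. grover E (x, y) g * ?p g)"
    unfolding evolve.simps
    by (rule sum.mono_neutral_right)
      (use finite_arcs[OF simple] sym in \<open>auto simp: arcs_def grover_def image_iff\<close>)
  also have "\<dots> = (\<Sum>z | E x z. grover E (x, y) (z, x) * ?p (z, x))"
    by (subst sum.reindex) (auto simp: inj_on_def)
  also have "\<dots> = (\<Sum>z | E x z. 2 / of_nat (deg E x) * ?p (z, x) - (if z = y then ?p (z, x) else 0))"
    by (rule sum.cong) (auto simp: grover_def algebra_simps)
  finally show ?thesis
    using finN assms(2) by (simp add: sum_subtractf sum_distrib_left)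
qed

text \<open>At degree 2 the reflection coefficient is 2/2 - 1 = 0 and the transmission coefficient
  is 1, so pulses pass unchanged.\<close>

lemma grover_degree_2:
  assumes "{y. E b y} = {a, d}" "a \<noteq> d" "e \<in> arcs E"
  shows "grover E e (a, b) = of_bool (e = (b, d))"
proof -
  have "deg E b = 2" using assms by (simp add: deg_def)
  moreover have "snd e = a \<or> snd e = d" if "fst e = b"
    using assms that by (cases e) (auto simp: arcs_def)
  ultimately show ?thesis using assms(2) by (cases e) (auto simp: grover_def)
qed

text \<open>From a + b = z a b the numbers a and b divide each other, so they are equal, and then 2
  = z a.\<close>

lemma reciprocals_sum_integral:
  assumes "a > 0" "b > 0" and "1 / of_nat a + 1 / of_nat b \<in> (\<int> :: complex set)"
  shows "(a = 1 \<and> b = 1) \<or> (a = 2 \<and> b = 2)"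
proof -
  obtain z where "1 / of_nat a + 1 / of_nat b = (of_int z :: complex)"
    using assms(3) by (auto elim: Ints_cases)
  then have "(of_int (int a + int b) :: complex) = of_int (z * int a * int b)"
    using assms(1,2) by (simp add: field_simps)
  then have z: "int a + int b = z * int a * int b" by (simp only: of_int_eq_iff)
  then have "int a dvd int a + int b" "int b dvd int a + int b" by (simp_all add: mult.assoc)
  then have "a dvd b" "b dvd a" by (simp_all flip: of_nat_add)
  then have ab: "a = b" by (rule dvd_antisym)
  then have "int a * 2 = int a * (z * int a)" using z by (simp add: algebra_simps)
  then have "2 = z * int a" using assms(1) by simp
  then have "int a dvd 2" by (metis dvd_triv_right)
  then have "a dvd 2" using int_dvd_int_iff[of a 2] by simp
  then have "a \<le> 2" by (auto dest: dvd_imp_le)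
  then show ?thesis using ab assms(1) by auto
qed

section \<open>The orbit of the edge opposite to \<open>u\<close>\<close>

theorem theorem3p4:
  fixes V :: "'a set" and E :: "'a \<Rightarrow> 'a \<Rightarrow> bool" and k :: nat
    and c :: "nat \<Rightarrow> 'a" and v1 w1 :: 'a
  assumes "k \<ge> 3" and "odd k"
    and "odd_unicycle V E" and "girth E = k"
    and "is_cycle E k c"
    and "deg E (c 0) = 4"
    and "\<forall>i. 1 \<le> i \<and> i \<le> k - 1 \<longrightarrow> deg E (c i) = 2"
    and "E (c 0) v1" and "E (c 0) w1" and "v1 \<noteq> w1"
    and "v1 \<notin> c ` {0..<k}" and "w1 \<notin> c ` {0..<k}"
    and "grover_periodic E"
  shows "(deg E v1 = 1 \<and> deg E w1 = 1) \<or> (deg E v1 = 2 \<and> deg E w1 = 2)"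
proof -
  obtain l where k: "k = 2 * l + 1" using \<open>odd k\<close> by (auto elim: oddE)
  then have l: "l \<ge> 1" using \<open>k \<ge> 3\<close> by simp
  \<comment> \<open>Indices are read modulo k, so the closing edge of the cycle is no special case;
    \<open>C 0\<close> is the vertex u.\<close>
  define C where "C i = c (i mod k)" for i
  have simple: "simple_graph V E" using assms(3) by (simp add: odd_unicycle_def)
  then have sym: "E y x" if "E x y" for x y using that by (auto simp: simple_graph_def)
  have finN: "finite {y. E x y}" for x
    using simple by (auto simp: simple_graph_def intro!: finite_subset[of "{y. E x y}" V])
  have C_eq: "C i = C j \<longleftrightarrow> i mod k = j mod k" for i j
    using assms(5) k unfolding is_cycle_def C_def by (auto simp: inj_on_eq_iff)
  have C_Suc: "E (C i) (C (Suc i))" for i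
  proof -
    have "i mod k < k" using k by simp
    then have "E (c (i mod k)) (c ((i mod k + 1) mod k))" using assms(5) unfolding is_cycle_def by blast
    then show ?thesis by (simp add: C_def mod_Suc_eq)
  qed
  have C_Suc': "E (C (Suc i)) (C i)" for i using C_Suc sym by blast
  have Suc_Suc_mod: "Suc (Suc i) mod k \<noteq> i mod k" for i
    using \<open>k \<ge> 3\<close> mod_eq_dvd_iff_nat[of i "Suc (Suc i)" k] by (auto dest: dvd_imp_le)
  have Suc_mod: "Suc i mod k \<noteq> i mod k" for i
    using \<open>k \<ge> 3\<close> mod_eq_dvd_iff_nat[of i "Suc i" k] by auto
  have nbrs: "{y. E (C (Suc i)) y} = {C i, C (Suc (Suc i))}" "C i \<noteq> C (Suc (Suc i))"
    if "Suc i mod k \<noteq> 0" for i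
  proof -
    show ne: "C i \<noteq> C (Suc (Suc i))" using Suc_Suc_mod[of i] by (simp add: C_eq)
    have "Suc i mod k < k" using k by simp
    then have "deg E (C (Suc i)) = 2" using assms(7) that by (simp add: C_def)
    then show "{y. E (C (Suc i)) y} = {C i, C (Suc (Suc i))}"
      using C_Suc C_Suc' ne finN by (intro card_subset_eq[symmetric]) (auto simp: deg_def)
  qed
  have C0: "C k = C 0" "c 0 = C 0" by (simp_all add: C_def)
  have k1: "Suc (k - 1) = k" using k by simp
  have ne1: "C 1 \<noteq> C (k - 1)" using l k by (simp add: C_eq)
  have off: "v1 \<noteq> C i" "w1 \<noteq> C i" "C i \<noteq> v1" "C i \<noteq> w1" for i
    using assms(11,12) k by (auto simp: C_def)
  have nbrs0: "{y. E (C 0) y} = {C 1, C (k - 1), v1, w1}"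
  proof (rule card_subset_eq[symmetric])
    show "{C 1, C (k - 1), v1, w1} \<subseteq> {y. E (C 0) y}"
      using C_Suc[of 0] C_Suc'[of "k - 1"] assms(8,9) k1 C0 by auto
    show "card {C 1, C (k - 1), v1, w1} = card {y. E (C 0) y}"
      using assms(6,10) off ne1 by (simp add: deg_def C0)
  qed (rule finN)
  have deg0: "deg E (C 0) = 4" using assms(6) C0 by simp

  \<comment> \<open>Both ends of this edge are at distance l from u along the cycle, so the start is
    symmetric and its two pulses reach u together. As m and m' differ, \<open>f\<close> is
    0/1-valued and serves both as initial vector and as diagonal projection.\<close>
  define m where "m = (C l, C (Suc l))"
  define m' where "m' = (C (Suc l), C l)"
  define f :: "'a \<times> 'a \<Rightarrow> complex" where "f e = of_bool (e = m) + of_bool (e = m')" for e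
  define p where "p = evolve (arcs E) (grover E) f"
  define a where "a n = p n m" for n
  have fin: "finite (arcs E)" using simple by (rule finite_arcs)
  have m: "m \<in> arcs E" "m' \<in> arcs E" "m \<noteq> m'"
    using C_Suc C_Suc' Suc_mod by (auto simp: m_def m'_def arcs_def C_eq)

  have step: "p (Suc n) (x, y) = 2 / of_nat (deg E x) * (\<Sum>z | E x z. p n (z, x)) - p n (y, x)"
    if "E x y" for n x y
    unfolding p_def using evolve_grover_Suc[OF simple that] .
  have fwd: "p (Suc n) (C (Suc i), C (Suc (Suc i))) = p n (C i, C (Suc i))"
    and bwd: "p (Suc n) (C (Suc i), C i) = p n (C (Suc (Suc i)), C (Suc i))"
    if "Suc i mod k \<noteq> 0" for n i
  proof -
    have "deg E (C (Suc i)) = 2" using nbrs[OF that] by (simp add: deg_def)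
    then show "p (Suc n) (C (Suc i), C (Suc (Suc i))) = p n (C i, C (Suc i))"
      "p (Suc n) (C (Suc i), C i) = p n (C (Suc (Suc i)), C (Suc i))"
      using nbrs[OF that] by (simp_all add: step[OF C_Suc] step[OF C_Suc'])
  qed

  \<comment> \<open>The reflection C i -> C (-i) fixes u and carries the first arc to the second,
    because -i = j + 1 and -(i + 1) = j modulo k.\<close>
  have refl: "p n (C i, C (Suc i)) = p n (C (Suc j), C j)" if "(i + j + 1) mod k = 0" for n i j
    using that
  proof (induction n arbitrary: i j)
    case 0
    \<comment> \<open>Matching the edge in the opposite direction would force l + 2 = l modulo k,
      impossible for k >= 3.\<close>
    have mid: "i mod k = l" if "(C i, C (Suc i)) = m \<or> (C (Suc i), C i) = m
        \<or> (C i, C (Suc i)) = m' \<or> (C (Suc i), C i) = m'" for i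
    proof (rule ccontr)
      assume "i mod k \<noteq> l"
      then have "i mod k = Suc l mod k" "Suc i mod k = l mod k"
        using that k by (auto simp: m_def m'_def C_eq)
      then have "Suc (Suc l) mod k = l mod k" by (metis mod_Suc_eq)
      then show False using Suc_Suc_mod by blast
    qed
    have val: "p 0 (C i, C (Suc i)) = of_bool (i mod k = l) \<and> p 0 (C (Suc i), C i) = of_bool (i mod k = l)" for i
    proof (cases "i mod k = l")
      case True
      then have "i mod k = l mod k" using k by simp
      moreover from this have "Suc i mod k = Suc l mod k" by (metis mod_Suc_eq)
      ultimately have "C i = C l" "C (Suc i) = C (Suc l)" by (simp_all only: C_eq)
      then show ?thesis using True m(3) by (auto simp: p_def f_def m_def m'_def)
    next
      case False
      then show ?thesis using mid[of i] by (auto simp: p_def f_def)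
    qed
    \<comment> \<open>The two residues add up to k - 1 = 2l, so one of them is l exactly when the
      other is.\<close>
    have "i mod k = l \<longleftrightarrow> j mod k = l"
    proof -
      have "(i mod k + j mod k + 1) mod k = 0"
        using 0 mod_Suc_eq[of "i mod k + j mod k" k] mod_Suc_eq[of "i + j" k] mod_add_eq[of i k j] by simp
      then obtain q where q: "i mod k + j mod k + 1 = k * q"
        by (auto simp: mod_eq_0_iff_dvd elim: dvdE)
      have "i mod k < k" "j mod k < k" using k by simp_all
      then have "k * q < k * 2" "k * q \<noteq> 0" using q by linarith+
      then have "q = 1" by (cases q) auto
      then have "i mod k + j mod k + 1 = k" using q by simp
      then show ?thesis using k by auto
    qed
    then show ?case by (simp add: val)
  next
    case (Suc n)
    \<comment> \<open>Shifting by k makes the index a successor, so that the preceding cycle vertex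
      can be named.\<close>
    have "C i = C (i + k)" "C (Suc i) = C (Suc (i + k))" by (simp_all add: C_def mod_Suc)
    moreover obtain i' where i': "i + k = Suc i'" using k by (cases "i + k") auto
    ultimately have Ci: "C i = C (Suc i')" "C (Suc i) = C (Suc (Suc i'))" by simp_all
    have "i' + Suc j + 1 = (i + j + 1) + k" using i' by simp
    then have sum: "(i' + Suc j + 1) mod k = 0" using Suc.prems by (simp only: mod_add_self2)
    have IH: "p n (C i', C (Suc i')) = p n (C (Suc (Suc j)), C (Suc j))"
      using Suc.IH[OF sum] .
    have zero_iff: "Suc i' mod k = 0 \<longleftrightarrow> Suc j mod k = 0"
    proof -
      have "k dvd Suc i' + Suc j" using sum by (simp add: mod_eq_0_iff_dvd)
      then have "k dvd Suc i' \<longleftrightarrow> k dvd Suc j" 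
        using dvd_add_left_iff[of k "Suc j" "Suc i'"] dvd_add_right_iff[of k "Suc i'" "Suc j"] by blast
      then show ?thesis by (simp add: mod_eq_0_iff_dvd)
    qed
    show ?case
    proof (cases "Suc j mod k = 0")
      \<comment> \<open>Both arcs leave u and share the sum over incoming arcs; only the reflected
        amplitudes differ in form, and the induction hypothesis equates them.\<close>
      case True
      then have "C (Suc i') = C 0" "C (Suc j) = C 0" using zero_iff by (simp_all add: C_eq)
      moreover from this have "E (C 0) (C (Suc (Suc i')))" "E (C 0) (C j)"
        using C_Suc[of "Suc i'"] C_Suc'[of j] by simp_all
      moreover have "C (Suc (Suc i')) = C (Suc (Suc j))"
        using True zero_iff by (metis C_eq mod_Suc_eq)
      moreover have "C i' = C j"
      proof -
        have "(Suc i' + (k - 1)) mod k = (Suc j + (k - 1)) mod k"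
          using True zero_iff mod_add_left_eq[of "Suc i'" k "k - 1"] mod_add_left_eq[of "Suc j" k "k - 1"]
          by simp
        moreover have "Suc x + (k - 1) = x + k" for x using k by simp
        ultimately show ?thesis by (simp only: C_eq mod_add_self2)
      qed
      ultimately show ?thesis using IH by (simp add: Ci step)
    next
      case False
      then show ?thesis using IH zero_iff by (simp add: Ci fwd bwd)
    qed
  qed
  have a': "p n m' = a n" for n
    using refl[of l l n] k by (simp add: a_def m_def m'_def mult_2)

  \<comment> \<open>The long way round from \<open>C (Suc l)\<close> to \<open>C l\<close>, through
    u, has 2l edges and avoids the opposite edge.\<close>
  have path: "(\<lambda>x y. E x y \<and> {x, y} \<noteq> {C l, C (Suc l)})\<^sup>*\<^sup>* (C (Suc l)) (C (Suc l + i))"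
    if "i \<le> 2 * l" for i
    using that
  proof (induction i)
    case (Suc i)
    have "C (Suc l + i) \<noteq> C l"
      using Suc.prems k mod_eq_dvd_iff_nat[of l "Suc l + i" k] by (auto simp: C_eq dest: dvd_imp_le)
    moreover have "C (Suc l + i) = C (Suc l) \<Longrightarrow> C (Suc (Suc l + i)) \<noteq> C l"
      using Suc_Suc_mod[of l] by (metis C_eq mod_Suc_eq)
    ultimately have "{C (Suc l + i), C (Suc (Suc l + i))} \<noteq> {C l, C (Suc l)}"
      by (auto simp: doubleton_eq_iff)
    then show ?case using Suc C_Suc[of "Suc l + i"] by (auto intro: rtranclp.rtrancl_into_rtrancl)
  qed simp
  have "Suc l + 2 * l = l + k" using k by simp
  then have wrap: "C (Suc l + 2 * l) = C l" by (simp only: C_eq mod_add_self2)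
  have path': "(\<lambda>x y. E x y \<and> {x, y} \<noteq> {C (Suc l), C l})\<^sup>*\<^sup>* (C (Suc l)) (C l)"
    using path[of "2 * l"] unfolding wrap by (simp add: insert_commute)
  obtain s where s: "s (C (Suc l)) = 1" "s (C l) = 1"
      "\<And>x y. E x y \<Longrightarrow> s x + s y = (2 :: complex) * of_bool ({x, y} = {C (Suc l), C l})"
    by (rule odd_unicycle_signing[OF assms(3) C_Suc' path']) (rule that)
  \<comment> \<open>The sign of an arc is that of its origin. A nonzero entry has fst e = snd g, and
    the signs at the two ends of g add up to 2 f g.\<close>
  have sign: "s (fst e) * grover E e g = grover E e g * (2 * f g - s (fst g))"
    if "e \<in> arcs E" "g \<in> arcs E" for e g
  proof (cases "snd g = fst e")
    case True
    have "s (fst g) + s (snd g) = 2 * of_bool ({fst g, snd g} = {C (Suc l), C l})"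
      using that s(3) by (auto simp: arcs_def)
    also have "of_bool ({fst g, snd g} = {C (Suc l), C l}) = f g"
      using m(3) by (cases g) (auto simp: f_def m_def m'_def doubleton_eq_iff)
    finally have "s (fst e) = 2 * f g - s (fst g)" using True by (simp add: eq_diff_eq add.commute)
    then show ?thesis by simp
  next
    case False
    then show ?thesis by (simp add: grover_def)
  qed
  have "(\<Sum>j\<le>n. (-1) ^ j * a j * a (n - j)) = a n" if "even n" for n
  proof (rule evolve_return_convolution[where s = "\<lambda>e. s (fst e)" and f = f and M = "grover E" and A = "arcs E"])
    show "f g * evolve (arcs E) (grover E) f n g = a n * f g" for n g
      using a'[of n] a_def[of n] by (auto simp: f_def p_def)
    show "s (fst e) * f e = f e" for e
      using s by (auto simp: f_def m_def m'_def)
    show "f m = 1" using m(3) by (simp add: f_def)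
  qed (use sign m that in auto)
  moreover obtain M where "M > 0" "\<And>n. of_nat M * a n \<in> \<int>"
  proof -
    obtain r where r: "r > 0"
      "\<forall>e\<in>arcs E. \<forall>g\<in>arcs E. mat_pow (arcs E) (grover E) r e g = (if e = g then 1 else 0)"
      using assms(13) unfolding grover_periodic_def by blast
    have period: "a (n + r) = a n" for n
      unfolding a_def p_def by (rule evolve_periodic[OF fin r(2) m(1)])
    have "a n \<in> \<rat>" for n
      unfolding a_def p_def by (rule evolve_Rats) (auto simp: grover_def f_def)
    then have "\<exists>M>0. \<forall>n. of_nat M * a n \<in> \<int>"
      using r(1) period by (rule periodic_common_denominator)
    then show ?thesis using that by blast
  qed
  ultimately have a_int: "a n \<in> \<int>" for n
    by (intro twisted_convolution_integral[of M a n])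

  \<comment> \<open>Until time l the wave consists of two unit pulses: one runs up to the arc (C (k
    - 1), C 0), the other down to (C 1, C 0).\<close>
  have front: "p j e = of_bool (e = (C (l + j), C (Suc (l + j)))) + of_bool (e = (C (Suc l - j), C (l - j)))"
    if "j \<le> l" "e \<in> arcs E" for j e
    using that
  proof (induction j arbitrary: e)
    case 0
    then show ?case by (simp add: p_def f_def m_def m'_def)
  next
    case (Suc j)
    \<comment> \<open>Writing l = i + j + 1 removes the truncated subtractions.\<close>
    obtain i where i: "l = Suc (i + j)" using Suc.prems by (metis le_Suc_ex add.commute add_Suc)
    then have d: "Suc l - j = Suc (Suc i)" "l - j = Suc i" "Suc l - Suc j = Suc i" "l - Suc j = i" by simp_all
    have nz: "Suc (l + j) mod k \<noteq> 0" "Suc i mod k \<noteq> 0" using i k by simp_all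
    have "p (Suc j) e = grover E e (C (l + j), C (Suc (l + j))) + grover E e (C (Suc l - j), C (l - j))"
      unfolding p_def
    proof (rule evolve_Suc_two_points)
      show "evolve (arcs E) (grover E) f j e
          = of_bool (e = (C (l + j), C (Suc (l + j)))) + of_bool (e = (C (Suc l - j), C (l - j)))"
        if "e \<in> arcs E" for e
        using Suc.IH[of e] Suc.prems that by (simp add: p_def)
    qed (use fin C_Suc C_Suc' d in \<open>auto simp: arcs_def\<close>)
    moreover have "grover E e (C (l + j), C (Suc (l + j))) = of_bool (e = (C (Suc (l + j)), C (Suc (Suc (l + j)))))"
      using nbrs[OF nz(1)] Suc.prems by (intro grover_degree_2) auto
    moreover have "grover E e (C (Suc (Suc i)), C (Suc i)) = of_bool (e = (C (Suc i), C i))"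
      using nbrs[OF nz(2)] Suc.prems by (intro grover_degree_2) auto
    ultimately show ?case by (simp add: d)
  qed
  \<comment> \<open>At degree 4 a pulse is transmitted with 1/2 and reflected with -1/2. On the
    cycle arcs out of u the two pulses cancel; on the arcs to v1 and w1 they add up to 1.\<close>
  have scatter: "p (Suc l) e = of_bool (e = (C 0, v1)) + of_bool (e = (C 0, w1))" if "e \<in> arcs E" for e
  proof -
    have last: "C (Suc (l + l)) = C 0" "C (l + l) = C (k - 1)" using k by (simp_all add: C_def mult_2)
    have "p (Suc l) e = grover E e (C (k - 1), C 0) + grover E e (C 1, C 0)"
      unfolding p_def
    proof (rule evolve_Suc_two_points)
      show "evolve (arcs E) (grover E) f l e = of_bool (e = (C (k - 1), C 0)) + of_bool (e = (C 1, C 0))"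
        if "e \<in> arcs E" for e
        using front[of l e] that last by (simp add: p_def)
    qed (use fin C_Suc'[of 0] C_Suc[of "k - 1"] k1 C0 in \<open>auto simp: arcs_def\<close>)
    moreover have "snd e \<in> {C 1, C (k - 1), v1, w1}" if "fst e = C 0"
      using \<open>e \<in> arcs E\<close> that nbrs0 by (cases e) (auto simp: arcs_def)
    ultimately show ?thesis
      using ne1 off assms(10) deg0 by (cases e) (auto simp: grover_def)
  qed
  have scatter2: "p (Suc (Suc l)) e = grover E e (C 0, v1) + grover E e (C 0, w1)" for e
    unfolding p_def
    by (rule evolve_Suc_two_points)
      (use fin assms(8,9) C0 scatter in \<open>auto simp: arcs_def p_def\<close>)
  \<comment> \<open>These are the reflection coefficients at v1 and w1.\<close>
  have v: "p (Suc (Suc l)) (v1, C 0) = 2 / of_nat (deg E v1) - 1"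
    and w: "p (Suc (Suc l)) (w1, C 0) = 2 / of_nat (deg E w1) - 1"
    using assms(10) by (auto simp: scatter2 grover_def)
  \<comment> \<open>What enters the cycle at time l + 3 travels unchanged for l steps and lies on m
    at time 2l + 3 = k + 2.\<close>
  have "p (Suc (Suc (Suc l)) + i) (C i, C (Suc i)) = p (Suc (Suc (Suc l))) (C 0, C 1)" if "i \<le> l" for i
    using that
  proof (induction i)
    case (Suc i)
    then have "Suc i mod k \<noteq> 0" using k by simp
    then show ?case using Suc fwd[of i "Suc (Suc (Suc l)) + i"] by simp
  qed simp
  then have "a (Suc (Suc (Suc l)) + l) = p (Suc (Suc (Suc l))) (C 0, C 1)"
    by (simp add: a_def m_def)
  also have "\<dots> = 1 / 2 * (\<Sum>z | E (C 0) z. p (Suc (Suc l)) (z, C 0)) - p (Suc (Suc l)) (C 1, C 0)"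
    using step[of "C 0" "C 1" "Suc (Suc l)"] C_Suc[of 0] deg0 by simp
  also have "(\<Sum>z | E (C 0) z. p (Suc (Suc l)) (z, C 0))
      = p (Suc (Suc l)) (C 1, C 0) + p (Suc (Suc l)) (C (k - 1), C 0)
        + p (Suc (Suc l)) (v1, C 0) + p (Suc (Suc l)) (w1, C 0)"
    unfolding nbrs0 using off ne1 assms(10) by simp
  \<comment> \<open>By symmetry the two cycle arcs into u carry a common value x, which cancels
    since (x + x)/2 - x = 0. Half the sum of the two reflection coefficients remains.\<close>
  also have "p (Suc (Suc l)) (C (k - 1), C 0) = p (Suc (Suc l)) (C 1, C 0)"
    using refl[of "k - 1" 0 "Suc (Suc l)"] k1 C0 by simp
  finally have "a (Suc (Suc (Suc l)) + l) = 1 / of_nat (deg E v1) + 1 / of_nat (deg E w1) - 1"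
    by (simp add: v w add_divide_distrib diff_divide_distrib)
  then have "1 / of_nat (deg E v1) + 1 / of_nat (deg E w1) = a (Suc (Suc (Suc l)) + l) + 1"
    by simp
  then have "1 / of_nat (deg E v1) + 1 / of_nat (deg E w1) \<in> (\<int> :: complex set)"
    using a_int by simp
  moreover have "deg E v1 > 0" "deg E w1 > 0"
    using sym assms(8,9) finN by (auto simp: deg_def card_gt_0_iff)
  ultimately show ?thesis by (intro reciprocals_sum_integral)
qed

end
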